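(* Let $A$ be a finite set of atoms, let $A'=\{a'\mid a\in A\}$ be a disjoint copy of $A$, and consider theories over the alphabet $A\cup A'$. Let $[A\leftarrow A']=\{a\leftarrow a'\mid a\in A\}$ and $[A'\leftarrow A]=\{a'\leftarrow a\mid a\in A\}$. For any propositional Horn theories $P$ and $R$ over $A$, $$P\cup R=cl_{head(R)}(P\circ[A\leftarrow A'])\circ cl_{body(P\circ[A\leftarrow A'])}(R)\circ cl_A([A'\leftarrow A]).$$
   Context: A theory over an alphabet is a finite set of rules $a_0\leftarrow a_1,\ldots,a_k$ ($k\ge0$), with $head(r)=\{a_0\}$, $body(r)=\{a_1,\ldots,a_k\}$, size $k$; for a set $S$ of rules $head(S),body(S)$ are the unions of heads and bodies. Write $S\subseteq_r R$ if $S\subseteq R$ has as many elements as the size of $r$. Composition: $P\circ R=\{head(r)\leftarrow body(S)\mid r\in P,\ S\subseteq_r R,\ head(S)=body(r)\}$. For a set of atoms $B$, $1_B=\{a\leftarrow a\mid a\in B\}$ and the closure is $cl_B(P)=1_B\cup P$. (Note $P\circ[A\leftarrow A']=\{head(r)\leftarrow body(r)'\mid r\in P\}$, where $body(r)'$ replaces each body atom by its copy.) *)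

theory Defs
  imports Main
begin

text \<open>The body of a rule \<open>a\<^sub>0 \<leftarrow> a\<^sub>1, \<dots>, a\<^sub>k\<close> is the set \<open>{a\<^sub>1, \<dots>, a\<^sub>k}\<close>, so the body atoms are
  understood to be pairwise distinct and the size \<open>k\<close> of the rule is the cardinality of its body.
  Facts have an empty body.\<close>

datatype 'a rule = Rule (hd_atom: 'a) (rbody: "'a set")

definition rhead :: "'a rule \<Rightarrow> 'a set" where
  "rhead r = {hd_atom r}"

definition rsize :: "'a rule \<Rightarrow> nat" where
  "rsize r = card (rbody r)"

definition heads :: "'a rule set \<Rightarrow> 'a set" where
  "heads S = (\<Union>r\<in>S. rhead r)"

definition bodies :: "'a rule set \<Rightarrow> 'a set" where
  "bodies S = (\<Union>r\<in>S. rbody r)"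

definition horn_theory :: "'a set \<Rightarrow> 'a rule set \<Rightarrow> bool" where
  "horn_theory X P \<longleftrightarrow>
     finite P \<and> (\<forall>r\<in>P. rhead r \<subseteq> X \<and> rbody r \<subseteq> X \<and> finite (rbody r))"

text \<open>\<open>subseteq_rule r S R\<close> is \<open>S \<subseteq>\<^sub>r R\<close>; finiteness of \<open>S\<close> is explicit because \<^const>\<open>card\<close> is \<open>0\<close> on
  infinite sets.\<close>

definition subseteq_rule :: "'a rule \<Rightarrow> 'a rule set \<Rightarrow> 'a rule set \<Rightarrow> bool" where
  "subseteq_rule r S R \<longleftrightarrow> S \<subseteq> R \<and> finite S \<and> card S = rsize r"

text \<open>Composition is not associative in general; iterated compositions without parentheses are
  read from left to right.\<close>

definition seq_comp :: "'a rule set \<Rightarrow> 'a rule set \<Rightarrow> 'a rule set" (infixl "\<odot>" 70) where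
  "P \<odot> R = {Rule (hd_atom r) (bodies S) | r S.
              r \<in> P \<and> subseteq_rule r S R \<and> heads S = rbody r}"

definition unit_theory :: "'a set \<Rightarrow> 'a rule set" where
  "unit_theory B = {Rule a {a} | a. a \<in> B}"

definition cl :: "'a set \<Rightarrow> 'a rule set \<Rightarrow> 'a rule set" where
  "cl B P = unit_theory B \<union> P"

text \<open>A disjoint copy \<open>A'\<close> of \<open>A\<close>, given by the bijection \<open>a \<mapsto> a'\<close> from \<open>A\<close> onto \<open>A'\<close>.\<close>

definition disjoint_copy :: "('a \<Rightarrow> 'a) \<Rightarrow> 'a set \<Rightarrow> 'a set \<Rightarrow> bool" where
  "disjoint_copy prime A A' \<longleftrightarrow> bij_betw prime A A' \<and> A \<inter> A' = {}"

text \<open>\<open>from_copy prime A\<close> is \<open>[A \<leftarrow> A']\<close> and \<open>to_copy prime A\<close> is \<open>[A' \<leftarrow> A]\<close>.\<close>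

definition from_copy :: "('a \<Rightarrow> 'a) \<Rightarrow> 'a set \<Rightarrow> 'a rule set" where
  "from_copy prime A = {Rule a {prime a} | a. a \<in> A}"

definition to_copy :: "('a \<Rightarrow> 'a) \<Rightarrow> 'a set \<Rightarrow> 'a rule set" where
  "to_copy prime A = {Rule (prime a) {a} | a. a \<in> A}"

end

theory Submission
  imports Defs
begin

text \<open>Priming the bodies of \<open>P\<close> keeps the rules of \<open>P\<close> and \<open>R\<close> apart: in
  \<open>cl\<^bsub>body(P \<circ> [A \<leftarrow> A'])\<^esub>(R)\<close> a primed atom is the head of its unit rule only, and an atom of
  \<open>head(R)\<close> is the head of rules of \<open>R\<close> only. So the primed rules of \<open>P\<close> pass through unchanged, and
  the unit rules for \<open>head(R)\<close> are replaced by the rules of \<open>R\<close>. The last factor removes the primes.\<close>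

lemma heads_eq: "heads S = hd_atom ` S"
  by (auto simp: heads_def rhead_def)

text \<open>Each composed rule arises from one rule of the left factor, so the unions hidden in
  \<open>cl\<close> on the left can be treated part by part. On the right a selection
  \<open>S\<close> may mix both parts, so there each closure must be kept whole.\<close>

lemma seq_comp_Un_left: "(P \<union> Q) \<odot> R = P \<odot> R \<union> Q \<odot> R"
  unfolding seq_comp_def by blast

text \<open>With one candidate rule per body atom, the condition on heads leaves a single choice of
  \<open>S\<close>, and composing just substitutes \<open>f b\<close> for each body atom
  \<open>b\<close>. Each composition below whose left factor is not a unit theory is of this
  kind.\<close>

lemma seq_comp_deterministic:
  assumes fin: "\<And>r. r \<in> P \<Longrightarrow> finite (rbody r)"
    and det: "\<And>b. b \<in> bodies P \<Longrightarrow> {s \<in> R. hd_atom s = b} = {Rule b (f b)}"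
  shows "P \<odot> R = (\<lambda>r. Rule (hd_atom r) (\<Union>(f ` rbody r))) ` P"
proof -
  define g where "g = (\<lambda>b. Rule b (f b))"
  have selection: "subseteq_rule r S R \<and> heads S = rbody r \<longleftrightarrow> S = g ` rbody r"
    if "r \<in> P" for r S
  proof
    assume S: "subseteq_rule r S R \<and> heads S = rbody r"
    have *: "s = g (hd_atom s)" "hd_atom s \<in> rbody r" if "s \<in> S" for s
    proof -
      show "hd_atom s \<in> rbody r" using S that by (auto simp: heads_eq)
      then have "hd_atom s \<in> bodies P" using \<open>r \<in> P\<close> by (auto simp: bodies_def)
      from det[OF this] show "s = g (hd_atom s)"
        using S that by (auto simp: g_def subseteq_rule_def)
    qed
    show "S = g ` rbody r"
    proof
      show "S \<subseteq> g ` rbody r" using * by blast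
      show "g ` rbody r \<subseteq> S"
      proof
        fix x assume "x \<in> g ` rbody r"
        then obtain b where b: "b \<in> rbody r" "x = g b" by (rule imageE)
        have "b \<in> hd_atom ` S" using S b(1) by (simp add: heads_eq)
        then obtain s where "s \<in> S" "b = hd_atom s" by (rule imageE)
        then show "x \<in> S" using *(1)[of s] b(2) by simp
      qed
    qed
  next
    assume S: "S = g ` rbody r"
    have "g b \<in> R" if "b \<in> rbody r" for b
      using det[of b] that \<open>r \<in> P\<close> by (auto simp: g_def bodies_def)
    \<comment> \<open>Since \<open>g b\<close> has head \<open>b\<close>, distinct body atoms select
      distinct rules; the size condition on \<open>S\<close> then holds automatically.\<close>
    moreover have "inj_on g (rbody r)" by (auto simp: g_def inj_on_def)
    moreover have "hd_atom ` g ` rbody r = rbody r" by (simp add: g_def image_image)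
    ultimately show "subseteq_rule r S R \<and> heads S = rbody r"
      using S fin[OF that] by (auto simp: subseteq_rule_def rsize_def heads_eq card_image)
  qed
  have "P \<odot> R = {Rule (hd_atom r) (bodies S) | r S. r \<in> P \<and> S = g ` rbody r}"
    unfolding seq_comp_def using selection by blast
  also have "\<dots> = (\<lambda>r. Rule (hd_atom r) (bodies (g ` rbody r))) ` P"
    by blast
  also have "\<dots> = (\<lambda>r. Rule (hd_atom r) (\<Union>(f ` rbody r))) ` P"
    by (simp add: bodies_def g_def)
  finally show ?thesis .
qed

text \<open>Here an atom of \<open>B\<close> may head several rules of \<open>R\<close>, so the
  selection is not forced. A unit rule has size 1, however, so \<open>S\<close> is a single rule,
  which is reproduced whole; the size condition prevents rules with a common head from being merged
  into one with the union of their bodies.\<close>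

lemma seq_comp_unit_left: "unit_theory B \<odot> R = {r \<in> R. hd_atom r \<in> B}"
proof (intro set_eqI iffI)
  fix x assume "x \<in> unit_theory B \<odot> R"
  then obtain a S where a: "a \<in> B" and x: "x = Rule a (bodies S)"
    and S: "S \<subseteq> R" "card S = 1" "hd_atom ` S = {a}"
    by (auto simp: seq_comp_def unit_theory_def subseteq_rule_def rsize_def heads_eq)
  from S(2) obtain s where "S = {s}" by (auto simp: card_1_singleton_iff)
  then show "x \<in> {r \<in> R. hd_atom r \<in> B}"
    using a x S by (cases s) (auto simp: bodies_def)
next
  fix x assume x: "x \<in> {r \<in> R. hd_atom r \<in> B}"
  let ?u = "Rule (hd_atom x) {hd_atom x}"
  have "?u \<in> unit_theory B" "subseteq_rule ?u {x} R" "heads {x} = rbody ?u"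
    "x = Rule (hd_atom ?u) (bodies {x})"
    using x by (auto simp: unit_theory_def subseteq_rule_def rsize_def heads_eq bodies_def)
  then show "x \<in> unit_theory B \<odot> R" unfolding seq_comp_def by blast
qed

theorem theorem5p7:
  fixes A A' :: "'a set" and prime :: "'a \<Rightarrow> 'a" and P R :: "'a rule set"
  assumes "finite A"
    and "disjoint_copy prime A A'"
    and "horn_theory A P"
    and "horn_theory A R"
  shows "P \<union> R =
    (cl (heads R) (P \<odot> from_copy prime A)
       \<odot> cl (bodies (P \<odot> from_copy prime A)) R)
       \<odot> cl A (to_copy prime A)"
proof -
  let ?Q = "P \<odot> from_copy prime A"
  let ?U = "cl (bodies ?Q) R"
  let ?T = "cl A (to_copy prime A)"
  have inj: "inj_on prime A" and copy: "prime ` A = A'" and disj: "A \<inter> A' = {}"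
    using assms(2) by (auto simp: disjoint_copy_def bij_betw_def)
  have P: "hd_atom r \<in> A" "rbody r \<subseteq> A" "finite (rbody r)" if "r \<in> P" for r
    using assms(3) that by (auto simp: horn_theory_def rhead_def)
  have R: "hd_atom r \<in> A" "rbody r \<subseteq> A" "finite (rbody r)" if "r \<in> R" for r
    using assms(4) that by (auto simp: horn_theory_def rhead_def)
  have bodies_P: "bodies P \<subseteq> A"
    unfolding bodies_def by (rule UN_least) (rule P(2))
  have bodies_R: "bodies R \<subseteq> A"
    unfolding bodies_def by (rule UN_least) (rule R(2))

  have "?Q = (\<lambda>r. Rule (hd_atom r) (\<Union>b\<in>rbody r. {prime b})) ` P"
  proof (rule seq_comp_deterministic[OF P(3)])
    fix b assume "b \<in> bodies P"
    then show "{s \<in> from_copy prime A. hd_atom s = b} = {Rule b {prime b}}"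
      using bodies_P by (auto simp: from_copy_def)
  qed
  then have Q: "?Q = (\<lambda>r. Rule (hd_atom r) (prime ` rbody r)) ` P"
    by (simp add: UNION_singleton_eq_range)
  have Q_fin: "finite (rbody r)" if "r \<in> ?Q" for r
    using that P(3) by (auto simp: Q)
  have bodies_Q: "bodies ?Q \<subseteq> A'"
    using bodies_P copy by (auto simp: Q bodies_def)

  have "?Q \<odot> ?U = (\<lambda>r. Rule (hd_atom r) (\<Union>b\<in>rbody r. {b})) ` ?Q"
  proof (rule seq_comp_deterministic[OF Q_fin])
    fix b assume "b \<in> bodies ?Q"
    then show "{s \<in> ?U. hd_atom s = b} = {Rule b {b}}"
      using bodies_Q disj R(1) by (auto simp: cl_def unit_theory_def)
  qed
  then have QU: "?Q \<odot> ?U = ?Q" by simp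
  \<comment> \<open>The unit rules in \<open>?U\<close> have their heads in
    \<open>bodies ?Q\<close>. None of these is a head of \<open>R\<close>, so filtering
    \<open>?U\<close> by \<open>heads R\<close> leaves exactly \<open>R\<close>.\<close>
  have "hd_atom r \<notin> bodies ?Q" if "r \<in> R" for r
    using R(1)[OF that] bodies_Q disj by blast
  then have "unit_theory (heads R) \<odot> ?U = R"
    unfolding seq_comp_unit_left
    by (auto simp: cl_def unit_theory_def heads_eq)
  then have first: "cl (heads R) ?Q \<odot> ?U = R \<union> ?Q"
    by (simp add: cl_def[of "heads R"] seq_comp_Un_left QU)

  \<comment> \<open>Bodies of \<open>R\<close> lie in \<open>A\<close>, while the rules of
    \<open>to_copy prime A\<close> have heads in \<open>A'\<close>; only the unit rules of
    \<open>?T\<close> apply.\<close>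
  have "R \<odot> ?T = (\<lambda>r. Rule (hd_atom r) (\<Union>b\<in>rbody r. {b})) ` R"
  proof (rule seq_comp_deterministic[OF R(3)])
    fix b assume "b \<in> bodies R"
    then show "{s \<in> ?T. hd_atom s = b} = {Rule b {b}}"
      using bodies_R copy disj by (auto simp: cl_def unit_theory_def to_copy_def)
  qed
  then have RT: "R \<odot> ?T = R" by simp
  \<comment> \<open>Now the unit rules of \<open>?T\<close> are excluded, their heads being
    unprimed, and injectivity of \<open>prime\<close> leaves one unpriming rule per atom. As bodies
    of \<open>P\<close> lie in \<open>A\<close>, \<open>inv_into A prime\<close> restores them
    exactly.\<close>
  have "?Q \<odot> ?T = (\<lambda>r. Rule (hd_atom r) (\<Union>b\<in>rbody r. {inv_into A prime b})) ` ?Q"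
  proof (rule seq_comp_deterministic[OF Q_fin])
    fix b assume "b \<in> bodies ?Q"
    then obtain a where "a \<in> A" "b = prime a" using bodies_Q copy by blast
    then show "{s \<in> ?T. hd_atom s = b} = {Rule b {inv_into A prime b}}"
      using inj copy disj
      by (auto simp: cl_def unit_theory_def to_copy_def inj_on_eq_iff)
  qed
  also have "\<dots> = (\<lambda>r. Rule (hd_atom r) (inv_into A prime ` prime ` rbody r)) ` P"
    by (simp add: Q image_image UNION_singleton_eq_range)
  also have "\<dots> = (\<lambda>r. r) ` P"
    by (rule image_cong) (use P(2) inj in \<open>auto simp: inv_into_image_cancel\<close>)
  finally have QT: "?Q \<odot> ?T = P" by simp
  show ?thesis by (simp only: first seq_comp_Un_left RT QT Un_commute)
qed

end
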